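(* Let $S$ be an ordered semigroup satisfying axioms O1–O6. Suppose that $S$ is simple and that there is no $e\in S$ such that $S=\{0,e,2e,\dots,\infty\}$. Then for every non-zero $x\in S$ there exists $z\in S$, $z\neq 0$, such that $2z\leq x$.
   Context: An ordered semigroup is an abelian monoid with a translation invariant order relation in which $0$ is the smallest element. For $s,t$ in an ordered set, $s\ll t$ means: for every increasing sequence $(t_n)$ (having a supremum) with $t\leq \sup_n t_n$ there is $n_0$ with $s\leq t_{n_0}$. Axioms on an ordered semigroup $S$: O1: every increasing sequence has a supremum. O2: every $s\in S$ is the supremum of a sequence $(s_n)$ with $s_n\ll s_{n+1}$ for all $n$. O3: if $s_i\ll t_i$ for $i=1,2$ then $s_1+s_2\ll t_1+t_2$. O4: if $(s_n),(t_n)$ are increasing then $\sup_n(s_n+t_n)=\sup_n s_n+\sup_n t_n$. O5: if $s'\ll s\leq t$ then there exists $r$ with $s'+r\leq t\leq s+r$. O6: if $s\leq r+t$ then for every $s'\ll s$ there exist $r',t'$ with $s'\leq r'+t'$, $r'\leq r$, $r'\leq s$, $t'\leq t$, $t'\leq s$. For $s\in S$, $\infty\cdot s:=\sup_n ns$. $S$ is simple if every non-zero element is full, i.e. $\infty\cdot s=\infty$ for every $s\neq 0$, where $\infty$ denotes the largest element of $S$. The expression $\{0,e,2e,\dots,\infty\}$ denotes the set of all multiples $ne$ ($n\geq 0$) together with $\infty$ (the multiples are not required to be distinct). *)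

theory Defs
  imports Complex_Main "HOL-Library.Lub_Glb"
begin

text \<open>
  The order of an ordered semigroup is a partial order.  Suprema are expressed relationally.
  Inside the class contexts \<open>monotone (\<le>) (\<le>) u\<close> is used since \<open>incseq\<close> is not available there;
  on types of class \<open>order\<close> it is literally \<open>incseq u\<close>.
\<close>

class ordered_semigroup = ordered_comm_monoid_add +
  assumes zero_least: "0 \<le> s"

context order
begin

definition is_sup :: "(nat \<Rightarrow> 'a) \<Rightarrow> 'a \<Rightarrow> bool" where
  "is_sup u v \<longleftrightarrow> (\<forall>n. u n \<le> v) \<and> (\<forall>w. (\<forall>n. u n \<le> w) \<longrightarrow> v \<le> w)"

definition way_below :: "'a \<Rightarrow> 'a \<Rightarrow> bool"  (infix \<open>\<lless>\<close> 50) where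
  "s \<lless> t \<longleftrightarrow>
    (\<forall>u v. monotone (\<le>) (\<le>) u \<longrightarrow> is_sup u v \<longrightarrow> t \<le> v \<longrightarrow> (\<exists>n. s \<le> u n))"

definition is_largest :: "'a \<Rightarrow> bool" where
  "is_largest m \<longleftrightarrow> (\<forall>y. y \<le> m)"

end

lemma is_sup_iff_isLub: "is_sup u v \<longleftrightarrow> isLub UNIV (range u) v"
  by (auto simp: is_sup_def isLub_def leastP_def isUb_def setle_def setge_def)

lemma way_below_iff:
  "s \<lless> t \<longleftrightarrow> (\<forall>u v. incseq u \<longrightarrow> is_sup u v \<longrightarrow> t \<le> v \<longrightarrow> (\<exists>n. s \<le> u n))"
  by (rule way_below_def)

class cu_semigroup = ordered_semigroup +
  assumes O1: "monotone (\<le>) (\<le>) u \<Longrightarrow> \<exists>v. is_sup u v"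
    and O2: "\<exists>u. (\<forall>n. u n \<lless> u (Suc n)) \<and> is_sup u s"
    and O3: "s1 \<lless> t1 \<Longrightarrow> s2 \<lless> t2 \<Longrightarrow> s1 + s2 \<lless> t1 + t2"
    and O4: "monotone (\<le>) (\<le>) u \<Longrightarrow> monotone (\<le>) (\<le>) v \<Longrightarrow> is_sup u a \<Longrightarrow> is_sup v b \<Longrightarrow>
      is_sup (\<lambda>n. u n + v n) (a + b)"
    and O5: "s' \<lless> s \<Longrightarrow> s \<le> t \<Longrightarrow> \<exists>r. s' + r \<le> t \<and> t \<le> s + r"
    and O6: "s \<le> r + t \<Longrightarrow> s' \<lless> s \<Longrightarrow>
      \<exists>r' t'. s' \<le> r' + t' \<and> r' \<le> r \<and> r' \<le> s \<and> t' \<le> t \<and> t' \<le> s"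

definition multiple :: "nat \<Rightarrow> 'a::comm_monoid_add \<Rightarrow> 'a" where
  "multiple n s = (\<Sum>i<n. s)"

text \<open>
  An element \<open>s\<close> is full if \<open>\<infinity> \<cdot> s\<close>, the supremum of its multiples, is the largest element.
\<close>

definition full :: "'a::cu_semigroup \<Rightarrow> bool" where
  "full s \<longleftrightarrow> (\<exists>m. is_sup (\<lambda>n. multiple n s) m \<and> is_largest m)"

text \<open>
  \<open>simple_on TYPE('a)\<close>: every non-zero element is full.  The type argument stands for the semigroup.
\<close>

definition simple_on :: "'a::cu_semigroup itself \<Rightarrow> bool" where
  "simple_on _ \<longleftrightarrow> (\<forall>s::'a. s \<noteq> 0 \<longrightarrow> full s)"

end

(* If x is a minimal non-zero element, then it is compact and, by O6 and simplicity, lies below every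
   non-zero element; repeatedly splitting off x with O5 shows that S consists of the multiples of x
   and the largest element.  Otherwise there is y with 0 < y < x, and O5 applied to a non-zero y' way
   below y gives y' + r \<le> x with r non-zero.  By O6 and simplicity, y' and r have a common non-zero
   lower bound z, and 2z \<le> x. *)
theory Submission
  imports Defs
begin

lemma multiple_0 [simp]: "multiple 0 s = 0"
  by (simp add: multiple_def)

lemma multiple_Suc: "multiple (Suc n) s = multiple n s + s"
  by (simp add: multiple_def)

lemma multiple_2: "multiple 2 s = s + s"
  by (simp add: multiple_Suc numeral_2_eq_2)

lemma le_add_right:
  fixes a b :: "'a::ordered_semigroup"
  shows "a \<le> a + b"
  using add_left_mono[OF zero_least, of a b] by simp

lemma incseq_multiple:
  fixes s :: "'a::ordered_semigroup"
  shows "incseq (\<lambda>n. multiple n s)"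
  by (rule incseq_SucI) (simp add: multiple_Suc le_add_right)

lemma way_below_imp_le:
  fixes s t :: "'a::order"
  assumes "s \<lless> t"
  shows "s \<le> t"
proof -
  have "incseq (\<lambda>n::nat. t)" and "is_sup (\<lambda>n::nat. t) t"
    by (simp_all add: is_sup_def)
  then show ?thesis
    using assms unfolding way_below_iff by blast
qed

lemma way_below_le_trans:
  fixes s t t' :: "'a::order"
  assumes "s \<lless> t" "t \<le> t'"
  shows "s \<lless> t'"
  using assms unfolding way_below_iff by (meson order_trans)

text \<open>Take a sequence as in O2. Each term is way below its successor, hence way below
  \<open>s\<close>. The terms cannot all vanish, since their supremum \<open>s\<close> is
  nonzero.\<close>

lemma nonzero_way_below:
  fixes s :: "'a::cu_semigroup"
  assumes "s \<noteq> 0"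
  obtains s' where "s' \<noteq> 0" "s' \<lless> s"
proof -
  obtain u where u: "\<And>n. u n \<lless> u (Suc n)" and sup: "is_sup u s"
    using O2 by blast
  have "\<exists>n. u n \<noteq> 0"
  proof (rule ccontr)
    assume "\<nexists>n. u n \<noteq> 0"
    then have "s \<le> 0"
      using sup by (auto simp: is_sup_def)
    then show False
      using assms zero_least[of s] by simp
  qed
  moreover have "u n \<lless> s" for n
    using u sup way_below_le_trans unfolding is_sup_def by blast
  ultimately show thesis
    using that by blast
qed

text \<open>Induction on \<open>n\<close>, with O6 peeling off one copy of \<open>a\<close>: the
  part \<open>t\<close> lies below both \<open>a\<close> and \<open>s\<close>, so it serves as
  \<open>z\<close> unless it is zero. O6 covers only some \<open>s' \<lless> s\<close>, so in that
  case the induction hypothesis is applied to \<open>s'\<close>; hence \<open>s\<close> must be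
  arbitrary.\<close>

lemma common_lower_bound_multiple:
  fixes a s :: "'a::cu_semigroup"
  assumes "s \<noteq> 0" "s \<le> multiple n a"
  shows "\<exists>z. z \<noteq> 0 \<and> z \<le> a \<and> z \<le> s"
  using assms
proof (induction n arbitrary: s)
  case 0
  then show ?case
    using zero_least[of s] by simp
next
  case (Suc n)
  obtain s' where s': "s' \<noteq> 0" "s' \<lless> s"
    using nonzero_way_below Suc.prems(1) .
  obtain r t where rt: "s' \<le> r + t" "r \<le> multiple n a" "t \<le> a" "t \<le> s"
    using O6[OF _ s'(2)] Suc.prems(2) unfolding multiple_Suc by blast
  show ?case
  proof (cases "t = 0")
    case True
    then have "s' \<le> multiple n a"
      using rt by (auto intro: order_trans)
    then show ?thesis
      using Suc.IH[OF s'(1)] way_below_imp_le[OF s'(2)] by (meson order_trans)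
  next
    case False
    then show ?thesis
      using rt by blast
  qed
qed

text \<open>Fullness bounds \<open>b\<close> only by the supremum of the multiples of
  \<open>a\<close>; a nonzero \<open>b'\<close> way below \<open>b\<close> already lies below a
  finite multiple.\<close>

lemma full_common_lower_bound:
  fixes a b :: "'a::cu_semigroup"
  assumes "full a" "b \<noteq> 0"
  obtains z where "z \<noteq> 0" "z \<le> a" "z \<le> b"
proof -
  obtain b' where b': "b' \<noteq> 0" "b' \<lless> b"
    using nonzero_way_below assms(2) .
  obtain n where "b' \<le> multiple n a"
    using assms(1) b'(2) incseq_multiple[of a]
    unfolding full_def is_largest_def way_below_iff by blast
  then obtain z where "z \<noteq> 0" "z \<le> a" "z \<le> b'"
    using common_lower_bound_multiple b'(1) by blast
  then show thesis
    using that way_below_imp_le[OF b'(2)] by (meson order_trans)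
qed

text \<open>Compactness allows \<open>s' = s = x\<close> in O5, whose two inequalities then make the
  subtraction of \<open>x\<close> exact. From an element that is no multiple of \<open>x\<close>,
  copies of \<open>x\<close> can be removed forever, so it dominates all multiples.\<close>

lemma compact_least_nonzero_multiples:
  fixes x :: "'a::cu_semigroup"
  assumes compact: "x \<lless> x" and least: "\<And>y. y \<noteq> 0 \<Longrightarrow> x \<le> y"
    and m: "is_sup (\<lambda>n. multiple n x) m" "is_largest m"
  shows "UNIV = range (\<lambda>n. multiple n x) \<union> {m}"
proof -
  have "y = m" if y: "\<And>n. y \<noteq> multiple n x" for y
  proof -
    have "\<exists>r. y = multiple n x + r" for n
    proof (induction n)
      case 0
      then show ?case by simp
    next
      case (Suc n)
      then obtain r where r: "y = multiple n x + r" by blast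
      \<comment> \<open>The remainder is nonzero, as otherwise \<open>y\<close> would equal
        \<open>multiple n x\<close>.\<close>
      then have "x \<le> r"
        using y[of n] least[of r] by (metis add.right_neutral)
      then obtain r' where "x + r' \<le> r" "r \<le> x + r'"
        using O5[OF compact] by blast
      then have "r = x + r'" by simp
      then show ?case
        using r by (auto simp: multiple_Suc add.assoc)
    qed
    then have "multiple n x \<le> y" for n
      using le_add_right by metis
    then show ?thesis
      using m by (simp add: is_sup_def is_largest_def order_antisym)
  qed
  then show ?thesis by blast
qed

theorem proposition5p2p1:
  fixes x :: "'a::cu_semigroup"
  assumes "simple_on TYPE('a)"
    and "\<not> (\<exists>(e::'a) m. is_largest m \<and> (UNIV::'a set) = range (\<lambda>n. multiple n e) \<union> {m})"
    and "x \<noteq> 0"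
  shows "\<exists>z. z \<noteq> 0 \<and> multiple 2 z \<le> x"
proof -
  have full: "full s" if "s \<noteq> 0" for s :: 'a
    using assms(1) that unfolding simple_on_def by blast
  have "\<exists>y. y \<noteq> 0 \<and> y < x"
  proof (rule ccontr)
    assume "\<nexists>y. y \<noteq> 0 \<and> y < x"
    then have minimal: "y = x" if "y \<noteq> 0" "y \<le> x" for y
      using that by (auto simp: order_le_less)
    \<comment> \<open>By minimality, a nonzero element way below \<open>x\<close> can only be
      \<open>x\<close> itself.\<close>
    have "x \<lless> x"
      using nonzero_way_below[OF assms(3)] minimal way_below_imp_le by metis
    \<comment> \<open>Likewise, a nonzero common lower bound of \<open>x\<close> and
      \<open>y\<close> must be \<open>x\<close>.\<close>
    moreover have "x \<le> y" if "y \<noteq> 0" for y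
      using full_common_lower_bound[OF full[OF assms(3)] that] minimal by metis
    moreover obtain m where "is_sup (\<lambda>n. multiple n x) m" "is_largest m"
      using full[OF assms(3)] unfolding full_def by blast
    ultimately show False
      using assms(2) compact_least_nonzero_multiples by blast
  qed
  then obtain y where y: "y \<noteq> 0" "y < x" by blast
  obtain y' where y': "y' \<noteq> 0" "y' \<lless> y"
    using nonzero_way_below y(1) .
  obtain r where r: "y' + r \<le> x" "x \<le> y + r"
    using O5[OF y'(2)] y(2) by (meson less_imp_le)
  \<comment> \<open>If \<open>r\<close> were zero, \<open>x \<le> y + r\<close> would contradict
    \<open>y < x\<close>.\<close>
  have "r \<noteq> 0"
    using r(2) y(2) by auto
  then obtain z where z: "z \<noteq> 0" "z \<le> y'" "z \<le> r"
    using full_common_lower_bound[OF full[OF y'(1)]] by blast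
  have "z + z \<le> x"
    using add_mono[OF z(2,3)] r(1) by (rule order_trans)
  then show ?thesis
    using z(1) by (auto simp: multiple_2)
qed

end
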